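(* A perm algebra $E$ factorizes through two given perm algebras $A$ and $V$ if and only if there exists a matched pair of perm algebras $(A,V,\blacktriangleright,\blacktriangleleft,\triangleright,\triangleleft)$ such that $E\cong A\bowtie V$ as perm algebras.
   Context: All vector spaces are over a field $\mathbb{K}$ of characteristic zero. A perm algebra is a vector space $A$ with a bilinear product satisfying $(a_1a_2)a_3=a_1(a_2a_3)=a_1(a_3a_2)$ for all $a_1,a_2,a_3\in A$ (no unit is required). A perm algebra $E$ factorizes through perm algebras $A$ and $V$ if $E$ contains (isomorphic copies of) $A$ and $V$ as perm subalgebras such that $E=A+V$ and $A\cap V=\{0\}$. Given perm algebras $A$ and $V$ and bilinear maps $\blacktriangleright:A\times V\to V$, $\blacktriangleleft:V\times A\to V$, $\triangleright:V\times A\to A$, $\triangleleft:A\times V\to A$, the tuple $(A,V,\blacktriangleright,\blacktriangleleft,\triangleright,\triangleleft)$ is a matched pair of perm algebras if the vector space $A\oplus V$ with the product $$(a_1,v_1)\ast(a_2,v_2)=\big(a_1a_2+v_1\triangleright a_2+a_1\triangleleft v_2,\ v_1v_2+a_1\blacktriangleright v_2+v_1\blacktriangleleft a_2\big)$$ is a perm algebra; this perm algebra is denoted $A\bowtie V$ and called the bicrossed product of $A$ by $V$. *)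

theory Defs
  imports "HOL-Analysis.Product_Vector"
begin

definition bilinear_map ::
  "('k::field \<Rightarrow> 'a::ab_group_add \<Rightarrow> 'a) \<Rightarrow> ('k \<Rightarrow> 'b::ab_group_add \<Rightarrow> 'b) \<Rightarrow>
   ('k \<Rightarrow> 'c::ab_group_add \<Rightarrow> 'c) \<Rightarrow> ('a \<Rightarrow> 'b \<Rightarrow> 'c) \<Rightarrow> bool"
where
  "bilinear_map s1 s2 s3 f \<longleftrightarrow>
     (\<forall>x. Vector_Spaces.linear s2 s3 (\<lambda>y. f x y)) \<and>
     (\<forall>y. Vector_Spaces.linear s1 s3 (\<lambda>x. f x y))"

locale perm_algebra = vector_space scale
  for scale :: "'k::field_char_0 \<Rightarrow> 'a::ab_group_add \<Rightarrow> 'a" +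
  fixes mult :: "'a \<Rightarrow> 'a \<Rightarrow> 'a"  (infixl \<open>\<cdot>\<close> 70)
  assumes bilinear_mult: "bilinear_map scale scale scale mult"
    and mult_assoc: "(x \<cdot> y) \<cdot> z = x \<cdot> (y \<cdot> z)"
    and mult_perm: "x \<cdot> (y \<cdot> z) = x \<cdot> (z \<cdot> y)"
begin

definition perm_subalgebra :: "'a set \<Rightarrow> bool" where
  "perm_subalgebra S \<longleftrightarrow> subspace S \<and> (\<forall>x\<in>S. \<forall>y\<in>S. x \<cdot> y \<in> S)"

end

definition perm_hom ::
  "('k::field_char_0 \<Rightarrow> 'a::ab_group_add \<Rightarrow> 'a) \<Rightarrow> ('a \<Rightarrow> 'a \<Rightarrow> 'a) \<Rightarrow>
   ('k \<Rightarrow> 'b::ab_group_add \<Rightarrow> 'b) \<Rightarrow> ('b \<Rightarrow> 'b \<Rightarrow> 'b) \<Rightarrow> ('a \<Rightarrow> 'b) \<Rightarrow> bool"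
where
  "perm_hom s1 m1 s2 m2 f \<longleftrightarrow>
     Vector_Spaces.linear s1 s2 f \<and> (\<forall>x y. f (m1 x y) = m2 (f x) (f y))"

definition perm_isomorphic ::
  "('k::field_char_0 \<Rightarrow> 'a::ab_group_add \<Rightarrow> 'a) \<Rightarrow> ('a \<Rightarrow> 'a \<Rightarrow> 'a) \<Rightarrow>
   ('k \<Rightarrow> 'b::ab_group_add \<Rightarrow> 'b) \<Rightarrow> ('b \<Rightarrow> 'b \<Rightarrow> 'b) \<Rightarrow> bool"
where
  "perm_isomorphic s1 m1 s2 m2 \<longleftrightarrow> (\<exists>f. perm_hom s1 m1 s2 m2 f \<and> bij f)"

text \<open>The isomorphic copies of \<open>A\<close> and \<open>V\<close> inside \<open>E\<close> are the subalgebras \<open>S\<close> and \<open>T\<close>.\<close>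

definition factorizes_through ::
  "('k::field_char_0 \<Rightarrow> 'e::ab_group_add \<Rightarrow> 'e) \<Rightarrow> ('e \<Rightarrow> 'e \<Rightarrow> 'e) \<Rightarrow>
   ('k \<Rightarrow> 'a::ab_group_add \<Rightarrow> 'a) \<Rightarrow> ('a \<Rightarrow> 'a \<Rightarrow> 'a) \<Rightarrow>
   ('k \<Rightarrow> 'v::ab_group_add \<Rightarrow> 'v) \<Rightarrow> ('v \<Rightarrow> 'v \<Rightarrow> 'v) \<Rightarrow> bool"
where
  "factorizes_through sE mE sA mA sV mV \<longleftrightarrow>
     (\<exists>S T. perm_algebra.perm_subalgebra sE mE S \<and>
            perm_algebra.perm_subalgebra sE mE T \<and>
            (\<exists>f. perm_hom sA mA sE mE f \<and> bij_betw f UNIV S) \<and>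
            (\<exists>g. perm_hom sV mV sE mE g \<and> bij_betw g UNIV T) \<and>
            {x + y | x y. x \<in> S \<and> y \<in> T} = UNIV \<and>
            S \<inter> T = {0})"

text \<open>
  Of the four maps of a matched pair, \<open>lactV\<close> and \<open>ractV\<close> are the left and right
  actions of \<open>A\<close> on \<open>V\<close> (black triangles pointing right and left), and \<open>lactA\<close> and
  \<open>ractA\<close> are the left and right actions of \<open>V\<close> on \<open>A\<close> (white triangles pointing
  right and left). Arguments come in the order in which they are written around
  the infix symbol.
\<close>

definition bicrossed_mult ::
  "('a::ab_group_add \<Rightarrow> 'a \<Rightarrow> 'a) \<Rightarrow> ('v::ab_group_add \<Rightarrow> 'v \<Rightarrow> 'v) \<Rightarrow>
   ('a \<Rightarrow> 'v \<Rightarrow> 'v) \<Rightarrow> ('v \<Rightarrow> 'a \<Rightarrow> 'v) \<Rightarrow> ('v \<Rightarrow> 'a \<Rightarrow> 'a) \<Rightarrow> ('a \<Rightarrow> 'v \<Rightarrow> 'a) \<Rightarrow>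
   'a \<times> 'v \<Rightarrow> 'a \<times> 'v \<Rightarrow> 'a \<times> 'v"
where
  "bicrossed_mult mA mV lactV ractV lactA ractA = (\<lambda>(a1, v1) (a2, v2).
     (mA a1 a2 + lactA v1 a2 + ractA a1 v2,
      mV v1 v2 + lactV a1 v2 + ractV v1 a2))"

locale matched_pair =
  A: perm_algebra sA mA + V: perm_algebra sV mV
  for sA :: "'k::field_char_0 \<Rightarrow> 'a::ab_group_add \<Rightarrow> 'a" and mA :: "'a \<Rightarrow> 'a \<Rightarrow> 'a"
    and sV :: "'k \<Rightarrow> 'v::ab_group_add \<Rightarrow> 'v" and mV :: "'v \<Rightarrow> 'v \<Rightarrow> 'v" +
  fixes lactV :: "'a \<Rightarrow> 'v \<Rightarrow> 'v" and ractV :: "'v \<Rightarrow> 'a \<Rightarrow> 'v"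
    and lactA :: "'v \<Rightarrow> 'a \<Rightarrow> 'a" and ractA :: "'a \<Rightarrow> 'v \<Rightarrow> 'a"
  assumes bilinear_lactV: "bilinear_map sA sV sV lactV"
    and bilinear_ractV: "bilinear_map sV sA sV ractV"
    and bilinear_lactA: "bilinear_map sV sA sA lactA"
    and bilinear_ractA: "bilinear_map sA sV sA ractA"
    and perm_algebra_bicrossed:
      "perm_algebra (module_prod.scale sA sV) (bicrossed_mult mA mV lactV ractV lactA ractA)"

end

theory Submission
  imports Defs
begin

text \<open>
  Suppose that \<open>E\<close> factorizes through \<open>A\<close> and \<open>V\<close>, with embeddings \<open>f\<close> and \<open>g\<close>. Since \<open>E\<close> is
  the direct sum of the images, \<open>h (a, v) = f a + g v\<close> is a linear bijection from \<open>A \<times> V\<close> onto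
  \<open>E\<close>. Write \<open>p\<close> and \<open>q\<close> for the two components of its inverse, so that \<open>f (p e) + g (q e) = e\<close>.
  The mixed products \<open>f a \<cdot> g v\<close> and \<open>g v \<cdot> f a\<close>, split into components by \<open>p\<close> and \<open>q\<close>,
  give four bilinear maps, and for these maps \<open>h\<close> turns the bicrossed product into the product of
  \<open>E\<close>. The perm identities therefore pull back along \<open>h\<close> to the bicrossed product
  (\<open>perm_algebra_pullback\<close>), which is to say that the four maps form a matched pair, and \<open>h\<close> is an
  isomorphism.

  Conversely, in \<open>A \<bowtie> V\<close> the coordinate embeddings \<open>a \<mapsto> (a, 0)\<close> and \<open>v \<mapsto> (0, v)\<close> are
  homomorphisms, because the actions are bilinear and so vanish when an argument is zero. Their
  images are complementary subalgebras, and an isomorphism \<open>A \<bowtie> V \<rightarrow> E\<close> carries them to a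
  factorization of \<open>E\<close>.
\<close>

lemma bilinear_map_linear_right:
  "bilinear_map s1 s2 s3 f \<Longrightarrow> Vector_Spaces.linear s2 s3 (\<lambda>y. f x y)"
  by (simp add: bilinear_map_def)

lemma bilinear_map_linear_left:
  "bilinear_map s1 s2 s3 f \<Longrightarrow> Vector_Spaces.linear s1 s3 (\<lambda>x. f x y)"
  by (simp add: bilinear_map_def)

lemma linear_zero_image: "Vector_Spaces.linear s1 s2 f \<Longrightarrow> f 0 = 0"
  by (rule module_hom.zero[OF module_hom_linearI])

lemma bilinear_map_zero:
  assumes "bilinear_map s1 s2 s3 f"
  shows bilinear_map_zero_left: "f 0 y = 0" and bilinear_map_zero_right: "f x 0 = 0"
  using linear_zero_image[OF bilinear_map_linear_left[OF assms]]
    linear_zero_image[OF bilinear_map_linear_right[OF assms]] by auto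

lemma bilinear_map_add:
  assumes "bilinear_map s1 s2 s3 f"
  shows bilinear_map_add_left: "f (x + x') y = f x y + f x' y"
    and bilinear_map_add_right: "f x (y + y') = f x y + f x y'"
  using bilinear_map_linear_left[OF assms] bilinear_map_linear_right[OF assms]
  by (auto simp: Vector_Spaces.linear_iff)

lemma bilinear_map_compose:
  assumes "bilinear_map s1 s2 s3 m" and "Vector_Spaces.linear t1 s1 f"
    and "Vector_Spaces.linear t2 s2 g" and "Vector_Spaces.linear s3 t3 p"
  shows "bilinear_map t1 t2 t3 (\<lambda>x y. p (m (f x) (g y)))"
  using assms by (simp add: bilinear_map_def Vector_Spaces.linear_iff)

lemma linear_inv_of_bij:
  assumes "Vector_Spaces.linear s1 s2 h" and "bij h"
  shows "Vector_Spaces.linear s2 s1 (inv h)"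
proof -
  interpret h: Vector_Spaces.linear s1 s2 h by fact
  have "inv h (x + y) = inv h x + inv h y" for x y
    by (rule inv_f_eq) (use assms(2) in \<open>auto simp: bij_def h.add surj_f_inv_f\<close>)
  moreover have "inv h (s2 c x) = s1 c (inv h x)" for c x
    by (rule inv_f_eq) (use assms(2) in \<open>auto simp: bij_def h.scale surj_f_inv_f\<close>)
  ultimately show ?thesis
    by (simp add: Vector_Spaces.linear_iff h.vs1.vector_space_axioms h.vs2.vector_space_axioms)
qed

lemma perm_hom_inv_of_bij:
  assumes "perm_hom s1 m1 s2 m2 h" and "bij h"
  shows "perm_hom s2 m2 s1 m1 (inv h)"
proof -
  have "inv h (m2 x y) = m1 (inv h x) (inv h y)" for x y
    by (rule inv_f_eq) (use assms in \<open>auto simp: bij_def perm_hom_def surj_f_inv_f\<close>)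
  then show ?thesis
    using assms linear_inv_of_bij by (auto simp: perm_hom_def)
qed

lemma perm_hom_compose:
  assumes "perm_hom s1 m1 s2 m2 f" and "perm_hom s2 m2 s3 m3 g"
  shows "perm_hom s1 m1 s3 m3 (\<lambda>x. g (f x))"
  using assms by (auto simp: perm_hom_def Vector_Spaces.linear_iff)

text \<open>
  That \<open>s1\<close> makes a vector space is part of the linearity of \<open>h\<close>; bilinearity of \<open>m1\<close> is a
  conclusion, because \<open>m1 x y\<close> equals \<open>inv h (m2 (h x) (h y))\<close>.
\<close>
lemma perm_algebra_pullback:
  assumes "perm_algebra s2 m2" and "perm_hom s1 m1 s2 m2 h" and "bij h"
  shows "perm_algebra s1 m1"
proof -
  interpret E: perm_algebra s2 m2 by fact
  have lin: "Vector_Spaces.linear s1 s2 h" and hm: "h (m1 x y) = m2 (h x) (h y)" for x y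
    using assms(2) by (auto simp: perm_hom_def)
  have inj: "inj h" using assms(3) by (simp add: bij_def)
  have vs: "vector_space s1" using lin by (simp add: Vector_Spaces.linear_iff)
  have "m1 = (\<lambda>x y. inv h (m2 (h x) (h y)))"
    by (intro ext) (simp add: hm[symmetric] inv_f_f[OF inj])
  moreover have "bilinear_map s1 s1 s1 (\<lambda>x y. inv h (m2 (h x) (h y)))"
    by (rule bilinear_map_compose[OF E.bilinear_mult lin lin linear_inv_of_bij[OF lin assms(3)]])
  ultimately have "bilinear_map s1 s1 s1 m1" by simp
  moreover have "m1 (m1 x y) z = m1 x (m1 y z)" for x y z
    by (rule injD[OF inj]) (simp add: hm E.mult_assoc)
  moreover have "m1 x (m1 y z) = m1 x (m1 z y)" for x y z
    by (rule injD[OF inj]) (simp add: hm E.mult_perm[of "h x" "h y" "h z"])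
  ultimately show ?thesis
    using vs by (simp add: perm_algebra_def perm_algebra_axioms_def)
qed

lemma perm_subalgebra_range:
  assumes "perm_algebra s2 m2" and "perm_hom s1 m1 s2 m2 f"
  shows "perm_algebra.perm_subalgebra s2 m2 (range f)"
proof -
  interpret E: perm_algebra s2 m2 by fact
  interpret f: Vector_Spaces.linear s1 s2 f using assms(2) by (simp add: perm_hom_def)
  have "m2 (f x) (f y) = f (m1 x y)" for x y
    using assms(2) by (simp add: perm_hom_def)
  then show ?thesis
    using f.subspace_image[OF f.vs1.subspace_UNIV] by (auto simp: E.perm_subalgebra_def)
qed

lemma bij_sum_of_complements:
  fixes f :: "'a::ab_group_add \<Rightarrow> 'e::ab_group_add" and g :: "'v::ab_group_add \<Rightarrow> 'e"
  assumes f: "Vector_Spaces.linear sA sE f" and g: "Vector_Spaces.linear sV sE g"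
    and "inj f" and "inj g"
    and span: "{x + y | x y. x \<in> range f \<and> y \<in> range g} = UNIV"
    and int: "range f \<inter> range g = {0}"
  shows "bij (\<lambda>(a, v). f a + g v)"
proof (rule bijI)
  interpret f: Vector_Spaces.linear sA sE f by fact
  interpret g: Vector_Spaces.linear sV sE g by fact
  show "inj (\<lambda>(a, v). f a + g v)"
  proof (rule injI, clarify)
    fix a v a' v'
    assume eq: "f a + g v = f a' + g v'"
    then have diff: "f (a - a') = g (v' - v)"
      by (simp add: f.diff g.diff algebra_simps)
    then have "f (a - a') \<in> range f \<inter> range g" by (metis IntI rangeI)
    then have "f (a - a') = 0" using int by blast
    with diff have "f a = f a'" and "g v' = g v" by (simp_all add: f.diff g.diff)
    then show "a = a' \<and> v = v'" using assms(3,4) by (auto dest: injD)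
  qed
  show "surj (\<lambda>(a, v). f a + g v)"
  proof (unfold surj_def, rule allI)
    fix e
    have "e \<in> {x + y | x y. x \<in> range f \<and> y \<in> range g}" by (simp add: span)
    then obtain a v where "e = f a + g v" by blast
    then show "\<exists>z. e = (case z of (a, v) \<Rightarrow> f a + g v)" by auto
  qed
qed

lemma matched_pair_if_factorizes:
  assumes E: "perm_algebra sE mE" and A: "perm_algebra sA mA" and V: "perm_algebra sV mV"
    and "factorizes_through sE mE sA mA sV mV"
  shows "\<exists>lactV ractV lactA ractA.
    matched_pair sA mA sV mV lactV ractV lactA ractA \<and>
    perm_isomorphic sE mE
      (module_prod.scale sA sV) (bicrossed_mult mA mV lactV ractV lactA ractA)"
proof -
  interpret E: perm_algebra sE mE by fact
  interpret A: perm_algebra sA mA by fact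
  interpret V: perm_algebra sV mV by fact
  from assms(4) obtain S T f g where f: "perm_hom sA mA sE mE f" and f_bij: "bij_betw f UNIV S"
    and g: "perm_hom sV mV sE mE g" and g_bij: "bij_betw g UNIV T"
    and sum: "{x + y | x y. x \<in> S \<and> y \<in> T} = UNIV" and inter: "S \<inter> T = {0}"
    unfolding factorizes_through_def by (elim exE conjE) (rule that)
  have "inj f" and "inj g" and images: "S = range f" "T = range g"
    using f_bij g_bij by (simp_all add: bij_betw_def)
  note span = sum[unfolded images] and int = inter[unfolded images]
  have lin_f: "Vector_Spaces.linear sA sE f" and f_mult: "f (mA x y) = mE (f x) (f y)" for x y
    using f by (simp_all add: perm_hom_def)
  have lin_g: "Vector_Spaces.linear sV sE g" and g_mult: "g (mV x y) = mE (g x) (g y)" for x y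
    using g by (simp_all add: perm_hom_def)
  interpret f: Vector_Spaces.linear sA sE f by fact
  interpret g: Vector_Spaces.linear sV sE g by fact
  interpret AV: vector_space_prod sA sV ..
  define h where "h = (\<lambda>(a, v). f a + g v)"
  have h_bij: "bij h"
    unfolding h_def by (rule bij_sum_of_complements[OF lin_f lin_g \<open>inj f\<close> \<open>inj g\<close> span int])
  have h_linear: "Vector_Spaces.linear AV.scale sE h"
    by (auto simp: Vector_Spaces.linear_iff h_def AV.p.vector_space_axioms E.vector_space_axioms
        AV.scale_def f.add g.add f.scale g.scale E.scale_right_distrib algebra_simps)
  define p q where "p = (\<lambda>e. fst (inv h e))" and "q = (\<lambda>e. snd (inv h e))"
  note h_inv_linear = linear_inv_of_bij[OF h_linear h_bij]
  have p_linear: "Vector_Spaces.linear sE sA p" and q_linear: "Vector_Spaces.linear sE sV q"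
    using Vector_Spaces.linear_compose[OF h_inv_linear AV.linear_fst]
      Vector_Spaces.linear_compose[OF h_inv_linear AV.linear_snd]
    by (simp_all add: p_def q_def comp_def)
  have split: "f (p e) + g (q e) = e" for e
    using surj_f_inv_f[OF bij_is_surj[OF h_bij], of e]
    by (simp add: h_def p_def q_def case_prod_beta)
  define lactV ractV lactA ractA
    where "lactV = (\<lambda>a v. q (mE (f a) (g v)))" and "ractV = (\<lambda>v a. q (mE (g v) (f a)))"
      and "lactA = (\<lambda>v a. p (mE (g v) (f a)))" and "ractA = (\<lambda>a v. p (mE (f a) (g v)))"
  let ?m = "bicrossed_mult mA mV lactV ractV lactA ractA"
  have "h (?m x y) = mE (h x) (h y)" for x y
  proof -
    obtain a v b w where xy: "x = (a, v)" "y = (b, w)" by fastforce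
    \<comment> \<open>Each mixed product of \<open>E\<close> appears as its \<open>f (p e)\<close> part plus its \<open>g (q e)\<close> part.\<close>
    have "h (?m x y) = f (mA a b) + g (mV v w)
      + (f (p (mE (g v) (f b))) + g (q (mE (g v) (f b))))
      + (f (p (mE (f a) (g w))) + g (q (mE (f a) (g w))))"
      by (simp add: xy h_def bicrossed_mult_def f.add g.add lactV_def ractV_def lactA_def ractA_def
          algebra_simps)
    also have "\<dots> = mE (f a + g v) (f b + g w)"
      by (simp add: split f_mult g_mult bilinear_map_add[OF E.bilinear_mult] algebra_simps)
    finally show ?thesis by (simp add: xy h_def)
  qed
  with h_linear have h_hom: "perm_hom AV.scale ?m sE mE h" by (simp add: perm_hom_def)
  have "bilinear_map sA sV sV lactV" "bilinear_map sV sA sV ractV"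
    "bilinear_map sV sA sA lactA" "bilinear_map sA sV sA ractA"
    unfolding lactV_def ractV_def lactA_def ractA_def
    by (rule bilinear_map_compose[OF E.bilinear_mult]; fact)+
  then have "matched_pair sA mA sV mV lactV ractV lactA ractA"
    using A V perm_algebra_pullback[OF E h_hom h_bij]
    by (simp add: matched_pair_def matched_pair_axioms_def)
  moreover have "perm_isomorphic sE mE AV.scale ?m"
    using perm_hom_inv_of_bij[OF h_hom h_bij] bij_imp_bij_inv[OF h_bij]
    by (auto simp: perm_isomorphic_def)
  ultimately show ?thesis by blast
qed

lemma (in matched_pair) factorizes_if_isomorphic_bicrossed:
  assumes E: "perm_algebra sE mE"
    and "perm_isomorphic sE mE
      (module_prod.scale sA sV) (bicrossed_mult mA mV lactV ractV lactA ractA)"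
  shows "factorizes_through sE mE sA mA sV mV"
proof -
  interpret AV: vector_space_prod sA sV ..
  let ?m = "bicrossed_mult mA mV lactV ractV lactA ractA"
  obtain k where k: "perm_hom sE mE AV.scale ?m k" "bij k"
    using assms(2) by (auto simp: perm_isomorphic_def)
  define h where "h = inv k"
  have h_hom: "perm_hom AV.scale ?m sE mE h"
    unfolding h_def by (rule perm_hom_inv_of_bij[OF k])
  have h_bij: "bij h" unfolding h_def by (rule bij_imp_bij_inv[OF k(2)])
  then have h_inj: "h x = h y \<longleftrightarrow> x = y" for x y by (auto simp: bij_def inj_eq)
  interpret h: Vector_Spaces.linear AV.scale sE h
    using h_hom by (simp add: perm_hom_def)
  note zeros = bilinear_map_zero[OF A.bilinear_mult] bilinear_map_zero[OF V.bilinear_mult]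
    bilinear_map_zero[OF bilinear_lactV] bilinear_map_zero[OF bilinear_ractV]
    bilinear_map_zero[OF bilinear_lactA] bilinear_map_zero[OF bilinear_ractA]
  have "perm_hom sA mA AV.scale ?m (\<lambda>a. (a, 0))" "perm_hom sV mV AV.scale ?m (\<lambda>v. (0, v))"
    by (auto simp: perm_hom_def Vector_Spaces.linear_iff bicrossed_mult_def zeros AV.scale_def
        A.vector_space_axioms V.vector_space_axioms AV.p.vector_space_axioms)
  then have f: "perm_hom sA mA sE mE (\<lambda>a. h (a, 0))" and g: "perm_hom sV mV sE mE (\<lambda>v. h (0, v))"
    using perm_hom_compose h_hom by blast+
  let ?S = "range (\<lambda>a. h (a, 0))" and ?T = "range (\<lambda>v. h (0, v))"
  have "bij_betw (\<lambda>a. h (a, 0)) UNIV ?S" "bij_betw (\<lambda>v. h (0, v)) UNIV ?T"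
    by (auto simp: bij_betw_def inj_on_def h_inj)
  moreover have "e \<in> {x + y | x y. x \<in> ?S \<and> y \<in> ?T}" for e
  proof -
    obtain a v where "e = h (a, v)"
      using bij_is_surj[OF h_bij] by (metis surjD surj_pair)
    then have "e = h (a, 0) + h (0, v)" by (simp add: h.add[symmetric])
    then show ?thesis by blast
  qed
  then have "{x + y | x y. x \<in> ?S \<and> y \<in> ?T} = UNIV" by blast
  moreover have "?S \<inter> ?T = {0}"
  proof -
    have "h (0, 0) = 0" using h.zero by (simp add: zero_prod_def)
    then show ?thesis by (auto simp: h_inj intro: range_eqI[of _ _ 0])
  qed
  ultimately show ?thesis
    using perm_subalgebra_range[OF E f] perm_subalgebra_range[OF E g] f g
    unfolding factorizes_through_def by blast
qed

theorem corollary2p16: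
  fixes sE :: "'k::field_char_0 \<Rightarrow> 'e::ab_group_add \<Rightarrow> 'e" and mE :: "'e \<Rightarrow> 'e \<Rightarrow> 'e"
    and sA :: "'k \<Rightarrow> 'a::ab_group_add \<Rightarrow> 'a" and mA :: "'a \<Rightarrow> 'a \<Rightarrow> 'a"
    and sV :: "'k \<Rightarrow> 'v::ab_group_add \<Rightarrow> 'v" and mV :: "'v \<Rightarrow> 'v \<Rightarrow> 'v"
  assumes "perm_algebra sE mE" and "perm_algebra sA mA" and "perm_algebra sV mV"
  shows "factorizes_through sE mE sA mA sV mV \<longleftrightarrow>
    (\<exists>lactV ractV lactA ractA.
       matched_pair sA mA sV mV lactV ractV lactA ractA \<and>
       perm_isomorphic sE mE
         (module_prod.scale sA sV) (bicrossed_mult mA mV lactV ractV lactA ractA))"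
  using matched_pair_if_factorizes[OF assms]
    matched_pair.factorizes_if_isomorphic_bicrossed[OF _ assms(1)]
  by blast

end
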